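(* Let $V_1, V_2$ be positive integers with $\gcd(V_1,V_2)=1$ and let $(V_m)_{m\ge 1}$ satisfy $V_m=V_{m-1}+V_{m-2}$ for $m\ge 3$. Let $n$ be a positive integer. Then the minimal set of generators of $S=\langle V_n,V_{n+2},V_{n+4},\ldots\rangle$ is \[ A=\{V_n,V_{n+2},\ldots,V_{n+2(\kappa-1)}\}, \] where $\kappa\ge 1$ is the integer given by $F_{2(\kappa-1)}\le V_n-1<F_{2\kappa}$.
   Context: For a set $A$ of positive integers, $\langle A\rangle$ denotes the set of all finite linear combinations of elements of $A$ with non-negative integer coefficients. A set $A$ is a minimal set of generators of $S$ if $\langle A\rangle=S$ and no proper subset of $A$ generates $S$; equivalently $A=S^{\star}\setminus(S^{\star}+S^{\star})$ with $S^{\star}=S\setminus\{0\}$. $F_m$ denotes the Fibonacci sequence: $F_0=0$, $F_1=F_2=1$, $F_m=F_{m-1}+F_{m-2}$. *)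

theory Defs
  imports Main "HOL-Number_Theory.Fib"
begin

definition nonneg_combs :: "nat set \<Rightarrow> nat set" where
  "nonneg_combs A = {\<Sum>a\<in>B. c a * a | B c. finite B \<and> B \<subseteq> A}"

definition minimal_generators :: "nat set \<Rightarrow> nat set \<Rightarrow> bool" where
  "minimal_generators A S \<longleftrightarrow>
     (\<forall>a\<in>A. 0 < a) \<and> nonneg_combs A = S \<and> (\<forall>B. B \<subset> A \<longrightarrow> nonneg_combs B \<noteq> S)"

end

theory Submission imports Defs "HOL-Number_Theory.Cong" begin

text \<open>
  Put \<open>a = V n\<close> and \<open>b = V (n + 1)\<close>, which are coprime. Then
  \<open>V (n + 2 i) = F(2i-1) a + F(2i) b\<close> with \<open>F(-1) = 1\<close>.

  If \<open>F(2i) < a\<close>, then in a representation \<open>V (n + 2 i) = s a + t b\<close> by earlier generators the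
  coefficient \<open>t\<close> is congruent to \<open>F(2i)\<close> modulo \<open>a\<close>, hence \<open>t \<ge> F(2i)\<close>; as the quotients
  \<open>F(2j-1) / F(2j)\<close> strictly decrease in \<open>j \<ge> 1\<close>, also \<open>s > F(2i-1)\<close>, and the sum is too large.

  If \<open>F(2i) \<ge> a\<close>, a greedy expansion of \<open>F(2i) - a\<close> in Fibonacci numbers of even index yields a
  combination of earlier generators of the form \<open>s a + (F(2i) - a) b\<close> with \<open>s \<le> F(2i-1)\<close>, and
  adding a multiple of \<open>a\<close> turns it into \<open>V (n + 2 i)\<close>.
\<close>

section \<open>Numerical semigroups\<close>

lemma nonneg_combs_zero: "0 \<in> nonneg_combs A"
  unfolding nonneg_combs_def by (intro CollectI exI[of _ "{}"]) auto

lemma nonneg_combs_add: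
  assumes "x \<in> nonneg_combs A" "y \<in> nonneg_combs A"
  shows "x + y \<in> nonneg_combs A"
proof -
  obtain B c where x: "x = (\<Sum>a\<in>B. c a * a)" "finite B" "B \<subseteq> A"
    using assms(1) by (auto simp: nonneg_combs_def)
  obtain C d where y: "y = (\<Sum>a\<in>C. d a * a)" "finite C" "C \<subseteq> A"
    using assms(2) by (auto simp: nonneg_combs_def)
  define e where "e a = (if a \<in> B then c a else 0) + (if a \<in> C then d a else 0)" for a
  have "(\<Sum>a\<in>B. c a * a) = (\<Sum>a\<in>B \<union> C. (if a \<in> B then c a else 0) * a)"
    by (rule sum.mono_neutral_cong_left) (use x y in auto)
  moreover have "(\<Sum>a\<in>C. d a * a) = (\<Sum>a\<in>B \<union> C. (if a \<in> C then d a else 0) * a)"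
    by (rule sum.mono_neutral_cong_left) (use x y in auto)
  ultimately have "x + y = (\<Sum>a\<in>B \<union> C. e a * a)"
    by (simp add: x(1) y(1) e_def add_mult_distrib sum.distrib)
  with x y show ?thesis
    unfolding nonneg_combs_def by blast
qed

lemma nonneg_combs_mult:
  assumes "x \<in> nonneg_combs A"
  shows "k * x \<in> nonneg_combs A"
  by (induction k) (use assms in \<open>auto intro: nonneg_combs_zero nonneg_combs_add\<close>)

lemma nonneg_combs_base:
  assumes "a \<in> A"
  shows "a \<in> nonneg_combs A"
  unfolding nonneg_combs_def
  by (intro CollectI exI[of _ "{a}"] exI[of _ "\<lambda>_. 1"]) (use assms in auto)

text \<open>Replaces coefficient functions by closure under addition, so that later arguments only
  need an invariant preserved by sums.\<close>

lemma nonneg_combs_induct [consumes 1, case_names zero add base]: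
  assumes "x \<in> nonneg_combs A"
    and zero: "P 0"
    and add: "\<And>x y. P x \<Longrightarrow> P y \<Longrightarrow> P (x + y)"
    and base: "\<And>a. a \<in> A \<Longrightarrow> P a"
  shows "P x"
proof -
  obtain B c where x: "x = (\<Sum>a\<in>B. c a * a)" "finite B" "B \<subseteq> A"
    using assms(1) by (auto simp: nonneg_combs_def)
  have mult: "P (k * a)" if "a \<in> A" for k a
    by (induction k) (use that zero add base in auto)
  have "P (\<Sum>a\<in>B. c a * a)"
    using x(2,3) by (induction B rule: finite_induct) (use zero add mult in auto)
  with x(1) show ?thesis by simp
qed

lemma nonneg_combs_subset:
  assumes "A \<subseteq> nonneg_combs B"
  shows "nonneg_combs A \<subseteq> nonneg_combs B"
proof
  fix x assume "x \<in> nonneg_combs A"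
  then show "x \<in> nonneg_combs B"
    by (induction rule: nonneg_combs_induct)
      (use assms in \<open>auto intro: nonneg_combs_zero nonneg_combs_add\<close>)
qed

lemma nonneg_combs_mono: "A \<subseteq> B \<Longrightarrow> nonneg_combs A \<subseteq> nonneg_combs B"
  by (rule nonneg_combs_subset) (auto intro: nonneg_combs_base)

lemma nonneg_combs_restrict:
  assumes "x \<in> nonneg_combs A"
  shows "x \<in> nonneg_combs (A \<inter> {..x})"
  using assms
proof (induction rule: nonneg_combs_induct)
  case zero
  show ?case by (rule nonneg_combs_zero)
next
  case (add x y)
  have "x \<in> nonneg_combs (A \<inter> {..x + y})" "y \<in> nonneg_combs (A \<inter> {..x + y})"
    by (rule subsetD[OF nonneg_combs_mono add.IH(1)], fastforce)
      (rule subsetD[OF nonneg_combs_mono add.IH(2)], fastforce)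
  then show ?case by (rule nonneg_combs_add)
next
  case (base a)
  then show ?case by (auto intro: nonneg_combs_base)
qed

text \<open>If some \<open>a\<close> in \<open>A\<close> were missing from \<open>B\<close>, the
  elements of \<open>B\<close> used to build \<open>a\<close> would all lie below \<open>a\<close>,
  hence be combinations of elements of \<open>A\<close> below \<open>a\<close>; then so would
  \<open>a\<close>.\<close>

lemma generators_contain_irreducibles:
  assumes irred: "\<And>a. a \<in> A \<Longrightarrow> a \<notin> nonneg_combs (A \<inter> {..<a})"
    and gen: "nonneg_combs B = nonneg_combs A"
  shows "A \<subseteq> B"
proof (rule ccontr)
  assume "\<not> A \<subseteq> B"
  then obtain a where a: "a \<in> A" "a \<notin> B" by blast
  have "B \<inter> {..a} \<subseteq> nonneg_combs (A \<inter> {..<a})"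
  proof
    fix b assume b: "b \<in> B \<inter> {..a}"
    with a have "b < a" by (cases "b = a") auto
    from b gen have "b \<in> nonneg_combs A" by (auto intro: nonneg_combs_base)
    then have "b \<in> nonneg_combs (A \<inter> {..b})" by (rule nonneg_combs_restrict)
    then show "b \<in> nonneg_combs (A \<inter> {..<a})"
      by (rule subsetD[OF nonneg_combs_mono, rotated]) (use \<open>b < a\<close> in auto)
  qed
  then have "nonneg_combs (B \<inter> {..a}) \<subseteq> nonneg_combs (A \<inter> {..<a})"
    by (rule nonneg_combs_subset)
  moreover have "a \<in> nonneg_combs (B \<inter> {..a})"
    using a gen by (auto intro: nonneg_combs_restrict nonneg_combs_base)
  ultimately show False using irred[OF a(1)] by blast
qed

lemma minimal_generators_unique:
  assumes pos: "\<And>a. a \<in> A \<Longrightarrow> 0 < a"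
    and irred: "\<And>a. a \<in> A \<Longrightarrow> a \<notin> nonneg_combs (A \<inter> {..<a})"
  shows "minimal_generators B (nonneg_combs A) \<longleftrightarrow> B = A"
proof
  assume B: "minimal_generators B (nonneg_combs A)"
  then have "nonneg_combs B = nonneg_combs A" by (simp add: minimal_generators_def)
  with irred have "A \<subseteq> B" by (rule generators_contain_irreducibles)
  with B show "B = A" by (auto simp: minimal_generators_def)
next
  have "nonneg_combs C \<noteq> nonneg_combs A" if "C \<subset> A" for C
    using generators_contain_irreducibles[OF irred, of C] that by blast
  moreover assume "B = A"
  ultimately show "minimal_generators B (nonneg_combs A)"
    using pos by (simp add: minimal_generators_def)
qed

section \<open>Fibonacci numbers of even and odd index\<close>

text \<open>\<open>fib_pred_even i\<close> is \<open>F(2i-1)\<close>, with the convention \<open>F(-1) = 1\<close> at \<open>i = 0\<close>.\<close>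

definition fib_pred_even :: "nat \<Rightarrow> nat" where
  "fib_pred_even i = fib (2 * i + 1) - fib (2 * i)"

lemma fib_pred_even_0 [simp]: "fib_pred_even 0 = 1"
  by (simp add: fib_pred_even_def)

lemma fib_pred_even_Suc [simp]: "fib_pred_even (Suc i) = fib (Suc (2 * i))"
  by (simp add: fib_pred_even_def)

text \<open>Holds at \<open>i = 0\<close> thanks to F(-1) = 1. With \<open>fib_even_Suc\<close> it
  expresses everything in the pair F(2i-1), F(2i), so that Fibonacci identities become plain
  algebra.\<close>

lemma fib_odd_eq: "fib (Suc (2 * i)) = fib_pred_even i + fib (2 * i)"
  by (cases i) simp_all

lemma fib_even_Suc: "fib (2 * Suc i) = fib_pred_even i + 2 * fib (2 * i)"
  using fib_odd_eq[of i] by simp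

text \<open>Cassini's identity F(2i+1) F(2i-1) = F(2i)^2 + 1, written without subtraction.\<close>

lemma fib_pred_even_cassini:
  "(fib_pred_even i + fib (2 * i)) * fib_pred_even i = fib (2 * i) * fib (2 * i) + 1"
proof (induction i)
  case (Suc i)
  then show ?case
    unfolding fib_even_Suc fib_pred_even_Suc fib_odd_eq by (simp add: algebra_simps)
qed simp

lemma fib_quotient_less:
  assumes "j < i"
  shows "fib_pred_even i * fib (2 * j) < fib (2 * i) * fib_pred_even j"
proof -
  \<comment> \<open>With m = 2(j+d), these are F(m-1) F(2j) \<le> F(m) F(2j-1) and the same with m+1
    for m, made strict. Adding two consecutive inequalities gives the next. At \<open>d = 0\<close>
    the first is an equality and the second is Cassini.\<close>
  have step: "fib_pred_even (j + d) * fib (2 * j) \<le> fib (2 * (j + d)) * fib_pred_even j \<and>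
      fib (2 * (j + d)) * fib (2 * j) < (fib_pred_even (j + d) + fib (2 * (j + d))) * fib_pred_even j"
    for d
  proof (induction d)
    case 0
    show ?case using fib_pred_even_cassini[of j] by simp
  next
    case (Suc d)
    then show ?case
      unfolding add_Suc_right fib_even_Suc fib_pred_even_Suc fib_odd_eq
      by (simp add: algebra_simps)
  qed
  obtain d where "i = Suc (j + d)" using assms less_iff_Suc_add by auto
  with step[of d] show ?thesis
    by (simp only: fib_even_Suc fib_pred_even_Suc fib_odd_eq) (simp add: algebra_simps)
qed

lemma fib_even_less:
  assumes "i < j"
  shows "fib (2 * i) < fib (2 * j)"
proof -
  have "fib (2 * i) < fib (2 * Suc i)"
    using fib_odd_eq[of i] fib_neq_0_nat[of "Suc (2 * i)"] by simp
  also have "\<dots> \<le> fib (2 * j)" using assms by (intro fib_mono) simp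
  finally show ?thesis .
qed

lemma fib_even_ge: "i \<le> fib (2 * i)"
proof (induction i)
  case (Suc i)
  with fib_even_less[of i "Suc i"] show ?case by linarith
qed simp

lemma ex1_fib_even_bracket:
  "\<exists>!k. 1 \<le> k \<and> fib (2 * (k - 1)) \<le> v \<and> v < fib (2 * k)"
proof (rule ex_ex1I)
  define k where "k = (LEAST k. v < fib (2 * k))"
  have "v < fib (2 * Suc v)" using fib_even_ge[of "Suc v"] by linarith
  then have k: "v < fib (2 * k)" unfolding k_def by (rule LeastI)
  then have "1 \<le> k" by (cases k) auto
  moreover from this have "\<not> v < fib (2 * (k - 1))"
    unfolding k_def by (intro not_less_Least) simp
  ultimately show "\<exists>k. 1 \<le> k \<and> fib (2 * (k - 1)) \<le> v \<and> v < fib (2 * k)"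
    using k by (intro exI[of _ k]) simp
next
  fix k l
  assume "1 \<le> k \<and> fib (2 * (k - 1)) \<le> v \<and> v < fib (2 * k)"
    and "1 \<le> l \<and> fib (2 * (l - 1)) \<le> v \<and> v < fib (2 * l)"
  moreover have "k' \<le> l'" if "fib (2 * (k' - 1)) \<le> v" "v < fib (2 * l')" for k' l'
  proof -
    from that have "fib (2 * (k' - 1)) < fib (2 * l')" by linarith
    then have "k' - 1 < l'"
      using fib_mono[of "2 * l'" "2 * (k' - 1)"] by (meson leD leI mult_le_mono2)
    then show ?thesis by linarith
  qed
  ultimately show "k = l" by (meson le_antisym)
qed

section \<open>The sequence of generators\<close>

text \<open>For \<open>a = V n\<close> and \<open>b = V (n + 1)\<close> this is \<open>V (n + 2 i)\<close>.\<close>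

definition even_gen :: "nat \<Rightarrow> nat \<Rightarrow> nat \<Rightarrow> nat" where
  "even_gen a b i = fib_pred_even i * a + fib (2 * i) * b"

lemma even_gen_0 [simp]: "even_gen a b 0 = a"
  by (simp add: even_gen_def)

text \<open>The increment is V (n + 2 i + 1), the intermediate term of the sequence.\<close>

lemma even_gen_Suc: "even_gen a b (Suc i) = even_gen a b i + (fib (2 * i) * a + fib (Suc (2 * i)) * b)"
  unfolding even_gen_def fib_even_Suc fib_pred_even_Suc fib_odd_eq by (simp add: algebra_simps)

lemma strict_mono_even_gen:
  assumes "0 < b"
  shows "strict_mono (even_gen a b)"
  using assms fib_neq_0_nat[of "Suc (2 * i)" for i]
  by (simp add: strict_mono_Suc_iff even_gen_Suc)

text \<open>\<open>s\<close> counts the copies of \<open>a\<close> used by the greedy expansion of \<open>t\<close>; even-indexed Fibonacci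
  numbers are split off one at a time, so each parity of \<open>m\<close> needs its own step.\<close>

lemma greedy_combination:
  assumes "\<And>i. 2 * i \<le> m \<Longrightarrow> even_gen a b i \<in> nonneg_combs A"
    and "t < fib (Suc m)"
  shows "\<exists>s\<le>fib m. s * a + t * b \<in> nonneg_combs A"
  using assms
proof (induction m arbitrary: t rule: fib.induct)
  case 1
  then show ?case by (auto intro: nonneg_combs_zero)
next
  case 2
  then show ?case by (auto intro!: exI[of _ 0] nonneg_combs_zero)
next
  case (3 m)
  have gens: "2 * i \<le> Suc (Suc m) \<Longrightarrow> even_gen a b i \<in> nonneg_combs A" for i
    by (rule "3.prems")
  have IH0: "\<exists>s\<le>fib m. s * a + t * b \<in> nonneg_combs A" if "t < fib (Suc m)" for t
    by (rule "3.IH") (use gens that in auto)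
  have IH1: "\<exists>s\<le>fib (Suc m). s * a + t * b \<in> nonneg_combs A" if "t < fib (Suc (Suc m))" for t
    by (rule "3.IH") (use gens that in auto)
  have split_off: "\<exists>s\<le>k + fib_pred_even i. s * a + t * b \<in> nonneg_combs A"
    if "2 * i \<le> Suc (Suc m)" "fib (2 * i) \<le> t"
      "\<exists>s\<le>k. s * a + (t - fib (2 * i)) * b \<in> nonneg_combs A" for i k
  proof -
    from that(3) obtain s where s: "s \<le> k" "s * a + (t - fib (2 * i)) * b \<in> nonneg_combs A"
      by blast
    have "(s * a + (t - fib (2 * i)) * b) + even_gen a b i \<in> nonneg_combs A"
      by (rule nonneg_combs_add[OF s(2) gens[OF that(1)]])
    also have "(s * a + (t - fib (2 * i)) * b) + even_gen a b i =
        (s + fib_pred_even i) * a + ((t - fib (2 * i)) + fib (2 * i)) * b"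
      unfolding even_gen_def add_mult_distrib by simp
    finally show ?thesis using s(1) that(2)
      by (intro exI[of _ "s + fib_pred_even i"]) simp
  qed
  show ?case
  proof (cases "t < fib (Suc (Suc m))")
    case True
    from IH1[OF this] show ?thesis by (auto intro: trans_le_add1)
  next
    case False
    show ?thesis
    proof (cases "even m")
      case True
      then obtain j where j: "m = 2 * j" by (rule evenE)
      \<comment> \<open>Splitting off F(m+2) leaves a remainder below F(m+1); the count is at most
        F(m) + F(m+1) = F(m+2).\<close>
      have "\<exists>s\<le>fib m + fib_pred_even (Suc j). s * a + t * b \<in> nonneg_combs A"
        by (rule split_off[OF _ _ IH0]) (use False "3.prems"(2) j in auto)
      then show ?thesis by (simp add: j add.commute)
    next
      case odd: False
      then obtain j where j: "m = Suc (2 * j)" by (metis oddE Suc_eq_plus1)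
      \<comment> \<open>Here m+2 is odd, so F(m+1) is split off: the remainder is below F(m+2), and
        the count is at most F(m+1) + F(m).\<close>
      have "\<exists>s\<le>fib (Suc m) + fib_pred_even (Suc j). s * a + t * b \<in> nonneg_combs A"
        by (rule split_off[OF _ _ IH1]) (use False "3.prems"(2) j in auto)
      then show ?thesis by (simp add: j)
    qed
  qed
qed

lemma even_gen_reducible:
  assumes "0 < a" "a \<le> fib (2 * i)" "0 < i"
    and gens: "\<And>j. j < i \<Longrightarrow> even_gen a b j \<in> nonneg_combs A"
  shows "even_gen a b i \<in> nonneg_combs A"
proof -
  obtain k where k: "i = Suc k" using \<open>0 < i\<close> gr0_implies_Suc by blast
  \<comment> \<open>The odd bound 2i-1 admits only generators of index below \<open>i\<close>, and
    \<open>0 < a\<close> puts F(2i) - a below F(2i).\<close>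
  have "\<exists>s\<le>fib (Suc (2 * k)). s * a + (fib (2 * i) - a) * b \<in> nonneg_combs A"
    by (rule greedy_combination) (use assms k in \<open>auto intro!: gens\<close>)
  then obtain s where s: "s \<le> fib_pred_even i" "s * a + (fib (2 * i) - a) * b \<in> nonneg_combs A"
    by (auto simp: k)
  have "a \<in> nonneg_combs A" using gens[OF \<open>0 < i\<close>] by simp
  \<comment> \<open>The extra copies of \<open>a\<close> raise its coefficient to F(2i-1); the
    further \<open>b\<close> copies of \<open>a\<close> count as the \<open>a\<close> missing copies
    of \<open>b\<close>.\<close>
  then have "(fib_pred_even i - s + b) * a + (s * a + (fib (2 * i) - a) * b) \<in> nonneg_combs A"
    by (intro nonneg_combs_add nonneg_combs_mult s(2))
  moreover have "(fib_pred_even i - s + b) * a + (s * a + (fib (2 * i) - a) * b) =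
      (fib_pred_even i - s + s) * a + ((fib (2 * i) - a) + a) * b"
    unfolding add_mult_distrib by (simp add: mult.commute)
  ultimately show ?thesis
    using s(1) \<open>a \<le> fib (2 * i)\<close> by (simp add: even_gen_def)
qed

lemma even_gen_irreducible:
  assumes "coprime a b" "fib (2 * i) < a"
  shows "even_gen a b i \<notin> nonneg_combs (even_gen a b ` {..<i})"
proof
  \<comment> \<open>Says t / s < F(2i) / F(2i-1), cross-multiplied. It holds for each earlier
    generator and survives addition; the second alternative admits the empty sum.\<close>
  let ?P = "\<lambda>x. \<exists>s t. x = s * a + t * b \<and>
    (fib_pred_even i * t < fib (2 * i) * s \<or> s = 0 \<and> t = 0)"
  assume "even_gen a b i \<in> nonneg_combs (even_gen a b ` {..<i})"
  then have "?P (even_gen a b i)"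
  proof (induction rule: nonneg_combs_induct)
    case (add x y)
    then obtain s t s' t' where
      st: "x = s * a + t * b" "fib_pred_even i * t < fib (2 * i) * s \<or> s = 0 \<and> t = 0"
        "y = s' * a + t' * b" "fib_pred_even i * t' < fib (2 * i) * s' \<or> s' = 0 \<and> t' = 0"
      by blast
    have "x + y = (s + s') * a + (t + t') * b" using st by (simp add: algebra_simps)
    moreover have "fib_pred_even i * (t + t') < fib (2 * i) * (s + s') \<or> s + s' = 0 \<and> t + t' = 0"
      using st(2,4) by (auto simp: distrib_left)
    ultimately show ?case by blast
  next
    case (base x)
    then obtain j where "j < i" "x = even_gen a b j" by blast
    with fib_quotient_less[OF \<open>j < i\<close>] show ?case by (auto simp: even_gen_def)
  qed auto
  then obtain s t where eq: "even_gen a b i = s * a + t * b"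
    and st: "fib_pred_even i * t < fib (2 * i) * s \<or> s = 0 \<and> t = 0"
    by blast
  have "0 < a" using assms by simp
  moreover have "0 < fib_pred_even i" by (cases i) (simp_all add: fib_neq_0_nat)
  ultimately have "0 < even_gen a b i" by (simp add: even_gen_def)
  with eq st have less: "fib_pred_even i * t < fib (2 * i) * s" by auto
  have "[fib_pred_even i * a + fib (2 * i) * b = s * a + t * b] (mod a)"
    using eq by (simp add: even_gen_def)
  then have "[fib (2 * i) * b = t * b] (mod a)"
    by (simp add: cong_def)
  then have "[fib (2 * i) = t] (mod a)"
    using assms(1) by (simp add: cong_mult_rcancel_nat coprime_commute)
  \<comment> \<open>Since F(2i) < a, F(2i) is the least element of its residue class modulo
    \<open>a\<close>.\<close>
  then have "fib (2 * i) \<le> t"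
    using assms(2) by (metis cong_def mod_less mod_less_eq_dividend)
  then have "fib (2 * i) * fib_pred_even i \<le> fib_pred_even i * t"
    by (simp add: mult.commute)
  with less have "fib_pred_even i < s"
    using le_less_trans nat_mult_less_cancel_disj by blast
  then have "fib_pred_even i * a < s * a" using \<open>0 < a\<close> by simp
  moreover have "fib (2 * i) * b \<le> t * b" using \<open>fib (2 * i) \<le> t\<close> by simp
  ultimately show False using eq unfolding even_gen_def by linarith
qed

text \<open>Strong induction: from index \<open>k\<close> on, a \<le> F(2i), and
  \<open>even_gen_reducible\<close> only asks that the earlier generators already are combinations
  of the first \<open>k\<close>.\<close>

lemma nonneg_combs_even_gen_truncate:
  assumes "0 < a" "0 < k" "a \<le> fib (2 * k)"
  shows "nonneg_combs (range (even_gen a b)) = nonneg_combs (even_gen a b ` {..<k})"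
proof
  have "even_gen a b i \<in> nonneg_combs (even_gen a b ` {..<k})" for i
  proof (induction i rule: less_induct)
    case (less i)
    show ?case
    proof (cases "i < k")
      case True
      then show ?thesis by (auto intro: nonneg_combs_base)
    next
      case False
      then have "a \<le> fib (2 * i)"
        using assms(3) fib_mono[of "2 * k" "2 * i"] by linarith
      show ?thesis
        by (rule even_gen_reducible) (use assms less.IH False \<open>a \<le> fib (2 * i)\<close> in auto)
    qed
  qed
  then show "nonneg_combs (range (even_gen a b)) \<subseteq> nonneg_combs (even_gen a b ` {..<k})"
    by (intro nonneg_combs_subset) auto
qed (auto intro!: nonneg_combs_mono)

lemma minimal_generators_even_gen:
  assumes "coprime a b" "0 < a" "0 < b"
    and k: "1 \<le> k" "fib (2 * (k - 1)) \<le> a - 1" "a - 1 < fib (2 * k)"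
  shows "minimal_generators A (nonneg_combs (range (even_gen a b))) \<longleftrightarrow> A = even_gen a b ` {..<k}"
proof -
  have mono: "strict_mono (even_gen a b)" by (rule strict_mono_even_gen) fact
  have "nonneg_combs (range (even_gen a b)) = nonneg_combs (even_gen a b ` {..<k})"
    using assms by (intro nonneg_combs_even_gen_truncate) auto
  moreover have "minimal_generators A (nonneg_combs (even_gen a b ` {..<k})) \<longleftrightarrow>
      A = even_gen a b ` {..<k}"
  proof (rule minimal_generators_unique)
    fix x assume "x \<in> even_gen a b ` {..<k}"
    then obtain i where i: "i < k" "x = even_gen a b i" by blast
    have "even_gen a b 0 \<le> even_gen a b i"
      using mono by (simp only: strict_mono_less_eq)
    with i \<open>0 < a\<close> show "0 < x" by simp
    have "even_gen a b ` {..<k} \<inter> {..<x} \<subseteq> even_gen a b ` {..<i}"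
      using i mono by (auto simp: strict_mono_less)
    moreover have "fib (2 * i) < a"
      using fib_mono[of "2 * i" "2 * (k - 1)"] i(1) k(2) \<open>0 < a\<close> by linarith
    ultimately show "x \<notin> nonneg_combs (even_gen a b ` {..<k} \<inter> {..<x})"
      using even_gen_irreducible[OF \<open>coprime a b\<close>, of i] i(2)
      by (meson nonneg_combs_mono subsetD)
  qed
  ultimately show ?thesis by simp
qed

theorem theorem4p9:
  fixes V :: "nat \<Rightarrow> nat" and n :: nat
  assumes "0 < V 1" and "0 < V 2"
    and "gcd (V 1) (V 2) = 1"
    and "\<And>m. 3 \<le> m \<Longrightarrow> V m = V (m - 1) + V (m - 2)"
    and "1 \<le> n"
  shows "(\<exists>!\<kappa>::nat. 1 \<le> \<kappa> \<and> fib (2 * (\<kappa> - 1)) \<le> V n - 1 \<and> V n - 1 < fib (2 * \<kappa>)) \<and>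
    (\<forall>\<kappa>::nat. 1 \<le> \<kappa> \<and> fib (2 * (\<kappa> - 1)) \<le> V n - 1 \<and> V n - 1 < fib (2 * \<kappa>) \<longrightarrow>
      (\<forall>A. minimal_generators A (nonneg_combs {V (n + 2 * i) | i. True}) \<longleftrightarrow>
           A = {V (n + 2 * i) | i. i < \<kappa>}))"
proof -
  have rec: "V (Suc (Suc m)) = V (Suc m) + V m" if "1 \<le> m" for m
    using assms(4)[of "Suc (Suc m)"] that by simp
  have "0 < V n \<and> 0 < V (Suc n) \<and> coprime (V n) (V (Suc n))"
    using \<open>1 \<le> n\<close>
  proof (induction n rule: nat_induct_at_least)
    case base
    show ?case using assms(1-3) by (simp add: coprime_iff_gcd_eq_1 numeral_2_eq_2)
  next
    case (Suc m)
    then have "coprime (V (Suc m)) (V m)" by (simp add: coprime_commute)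
    then have "coprime (V (Suc m)) (V (Suc m) + V m)" by (simp add: coprime_iff_gcd_eq_1)
    with Suc.IH rec[OF Suc.hyps] show ?case by simp
  qed
  then have ab: "coprime (V n) (V (Suc n))" "0 < V n" "0 < V (Suc n)" by auto
  \<comment> \<open>The intermediate term is carried along because the recurrence needs two
    consecutive values.\<close>
  have "V (n + 2 * i) = even_gen (V n) (V (Suc n)) i \<and>
      V (Suc (n + 2 * i)) = fib (2 * i) * V n + fib (Suc (2 * i)) * V (Suc n)" for i
  proof (induction i)
    case 0
    show ?case by simp
  next
    case (Suc i)
    have "V (n + 2 * Suc i) = V (Suc (n + 2 * i)) + V (n + 2 * i)"
      using rec[of "n + 2 * i"] \<open>1 \<le> n\<close> by simp
    also have "\<dots> = even_gen (V n) (V (Suc n)) (Suc i)"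
      unfolding conjunct1[OF Suc.IH] conjunct2[OF Suc.IH] even_gen_Suc by (rule add.commute)
    finally have gen: "V (n + 2 * Suc i) = even_gen (V n) (V (Suc n)) (Suc i)" .
    have "V (Suc (n + 2 * Suc i)) = V (n + 2 * Suc i) + V (Suc (n + 2 * i))"
      using rec[of "Suc (n + 2 * i)"] by simp
    also have "\<dots> = fib (2 * Suc i) * V n + fib (Suc (2 * Suc i)) * V (Suc n)"
      unfolding gen conjunct2[OF Suc.IH] even_gen_def fib_odd_eq[of "Suc i"] fib_pred_even_Suc
      by (simp add: algebra_simps)
    finally show ?case using gen by blast
  qed
  then have gen: "V (n + 2 * i) = even_gen (V n) (V (Suc n)) i" for i by blast
  have all: "{V (n + 2 * i) | i. True} = range (even_gen (V n) (V (Suc n)))"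
    unfolding gen by blast
  have less: "{V (n + 2 * i) | i. i < k} = even_gen (V n) (V (Suc n)) ` {..<k}" for k
    unfolding gen by blast
  show ?thesis
    unfolding all less
  proof (intro conjI allI impI)
    show "\<exists>!\<kappa>. 1 \<le> \<kappa> \<and> fib (2 * (\<kappa> - 1)) \<le> V n - 1 \<and> V n - 1 < fib (2 * \<kappa>)"
      by (rule ex1_fib_even_bracket)
  next
    fix k A
    assume "1 \<le> k \<and> fib (2 * (k - 1)) \<le> V n - 1 \<and> V n - 1 < fib (2 * k)"
    then show "minimal_generators A (nonneg_combs (range (even_gen (V n) (V (Suc n))))) \<longleftrightarrow>
        A = even_gen (V n) (V (Suc n)) ` {..<k}"
      using minimal_generators_even_gen[OF ab] by blast
  qed
qed

end
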